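(* Let $n\geq 2$ and let $F:\mathbb{R}^{n+1}_1\to\mathbb{R}^{n+1}_1$, $(y_1,\dots,y_{n+1}) = F(x_1,\dots,x_{n+1})$, be a smooth diffeomorphism, where $(x_1,\dots,x_{n+1})$ are the standard coordinates. Then $F$ is a causal automorphism of $\mathbb{R}^{n+1}_1$ if and only if both of the following hold: (i) $\frac{\partial y_{n+1}}{\partial x_{n+1}} \geq 0$ everywhere; (ii) for every smooth function $\varphi$ on $\mathbb{R}^{n+1}$, $$\sum_{i=1}^n \frac{\partial^2 \varphi}{\partial x_i^2} - \frac{\partial^2 \varphi}{\partial x_{n+1}^2} = 0 \ \text{ everywhere} \iff \sum_{i=1}^n \frac{\partial^2 \varphi}{\partial y_i^2} - \frac{\partial^2 \varphi}{\partial y_{n+1}^2} = 0 \ \text{ everywhere},$$ where on the right $\varphi$ is expressed in the $y$-coordinates (i.e. as $\varphi\circ F^{-1}$).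
   Context: $\mathbb{R}^{n+1}_1$ denotes $\mathbb{R}^{n+1}$ with the Minkowski inner product of signature $(+,\dots,+,-)$: $\langle u,v\rangle = \sum_{i=1}^n u_i v_i - u_{n+1}v_{n+1}$. A vector $v\ne 0$ is causal if $\langle v,v\rangle\le 0$, and future-directed if moreover $v_{n+1}>0$. The causal relation is $p \le q$ iff $q-p$ is zero or a future-directed causal vector. A causal automorphism of $\mathbb{R}^{n+1}_1$ is a bijection $F:\mathbb{R}^{n+1}_1\to\mathbb{R}^{n+1}_1$ such that $p\le q \iff F(p)\le F(q)$ for all $p,q$. *)

theory Defs
  imports "HOL-Analysis.Analysis"
begin

text \<open>Minkowski space R^{n+1}_1 is modelled as (real^'n) \<times> real:
  the first component holds the spatial coordinates x_1..x_n (indexed by the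
  finite type 'n, n = CARD('n)), the second component is the time coordinate x_{n+1}.\<close>

type_synonym 'n spacetime = "(real ^ 'n) \<times> real"

definition mink :: "'n::finite spacetime \<Rightarrow> 'n spacetime \<Rightarrow> real" where
  "mink u v = fst u \<bullet> fst v - snd u * snd v"

definition causal_vec :: "'n::finite spacetime \<Rightarrow> bool" where
  "causal_vec v \<longleftrightarrow> v \<noteq> 0 \<and> mink v v \<le> 0"

definition future_causal :: "'n::finite spacetime \<Rightarrow> bool" where
  "future_causal v \<longleftrightarrow> causal_vec v \<and> snd v > 0"

definition causal_le :: "'n::finite spacetime \<Rightarrow> 'n spacetime \<Rightarrow> bool" where
  "causal_le p q \<longleftrightarrow> q - p = 0 \<or> future_causal (q - p)"

definition causal_automorphism :: "('n::finite spacetime \<Rightarrow> 'n spacetime) \<Rightarrow> bool" where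
  "causal_automorphism F \<longleftrightarrow> bij F \<and> (\<forall>p q. causal_le p q \<longleftrightarrow> causal_le (F p) (F q))"

fun iter_dderiv :: "('a::real_normed_vector \<Rightarrow> 'b::real_normed_vector) \<Rightarrow> 'a list \<Rightarrow> 'a \<Rightarrow> 'b" where
  "iter_dderiv f [] = f"
| "iter_dderiv f (v # vs) = (\<lambda>x. frechet_derivative (iter_dderiv f vs) (at x) v)"

text \<open>Smooth (C^infinity) on the whole space: every iterated directional derivative
  exists and is (Frechet) differentiable everywhere. In finite dimensions this is
  exactly C^infinity (differentiable implies continuous partials).\<close>

definition smooth :: "('a::euclidean_space \<Rightarrow> 'b::real_normed_vector) \<Rightarrow> bool" where
  "smooth f \<longleftrightarrow> (\<forall>vs x. iter_dderiv f vs differentiable (at x))"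

definition diffeomorphism :: "('a::euclidean_space \<Rightarrow> 'a) \<Rightarrow> bool" where
  "diffeomorphism F \<longleftrightarrow> bij F \<and> smooth F \<and> smooth (inv F)"

definition space_dir :: "'n::finite \<Rightarrow> 'n spacetime" where
  "space_dir i = (axis i 1, 0)"

definition time_dir :: "'n::finite spacetime" where
  "time_dir = (0, 1)"

definition wave :: "('n::finite spacetime \<Rightarrow> real) \<Rightarrow> 'n spacetime \<Rightarrow> real" where
  "wave \<phi> x = (\<Sum>i\<in>UNIV. iter_dderiv \<phi> [space_dir i, space_dir i] x)
               - iter_dderiv \<phi> [time_dir, time_dir] x"

end

theory Submission
  imports Defs
begin

text \<open>A causal automorphism preserves null separation, since \<open>p \<le> q\<close> are null separated iff the causal
  interval between them is a chain; hence it maps null lines to null lines. Comparing parallel null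
  lines gives \<open>F (p + u + v) - F (p + u) = F (p + v) - F p\<close> for null \<open>u\<close>, \<open>v\<close> that are not parallel.
  For \<open>n \<ge> 2\<close> the null vectors not parallel to a given one still span the space, so \<open>F\<close> is affine, and
  its linear part is conformal because it preserves null vectors; this rescales the wave operator.

  Conversely, if the wave equation is invariant, then its solutions \<open>y \<bullet> u\<close> and \<open>(y \<bullet> u)\<^sup>2\<close>
  for null \<open>u\<close> pull back to solutions, which says that the adjoint of the derivative of \<open>F\<close> preserves null vectors. Hence
  the derivative is conformal at every point, with a positive factor as \<open>n \<ge> 2\<close>, and by (i) it maps the
  future causal cone onto itself. The mean value theorem and self-duality of the cone then give
  monotonicity of \<open>F\<close> and of its inverse.\<close>

section \<open>Minkowski geometry\<close>

text \<open>The future cone with its apex, so that \<open>causal_le\<close> is membership of the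
  difference and zero needs no separate case.\<close>

definition causal_cone :: "'n::finite spacetime set" where
  "causal_cone = {v. norm (fst v) \<le> snd v}"

text \<open>The matrix of \<open>mink\<close> with respect to the Euclidean inner product. It
  expresses Minkowski adjoints through \<open>adjoint\<close> and the wave operator as a
  trace.\<close>

definition time_reflection :: "'n::finite spacetime \<Rightarrow> 'n spacetime" where
  "time_reflection v = (fst v, - snd v)"

lemma mink_eq_inner: "mink u v = u \<bullet> time_reflection v"
  by (simp add: mink_def time_reflection_def inner_prod_def)

lemma time_reflection_involution [simp]: "time_reflection (time_reflection v) = v"
  by (simp add: time_reflection_def)

lemma time_reflection_inner: "time_reflection u \<bullet> v = u \<bullet> time_reflection v"
  by (simp add: time_reflection_def inner_prod_def)

lemma mink_commute: "mink u v = mink v u"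
  by (simp add: mink_def inner_commute mult.commute)

lemma mink_simps:
  "mink (u + v) w = mink u w + mink v w" "mink w (u + v) = mink w u + mink w v"
  "mink (u - v) w = mink u w - mink v w" "mink w (u - v) = mink w u - mink w v"
  "mink (c *\<^sub>R u) w = c * mink u w" "mink w (c *\<^sub>R u) = c * mink w u"
  "mink (- u) w = - mink u w" "mink w (- u) = - mink w u"
  "mink 0 w = 0" "mink w 0 = 0"
  by (simp_all add: mink_def algebra_simps)

lemma mink_self: "mink v v = (norm (fst v))\<^sup>2 - (snd v)\<^sup>2"
  by (simp add: mink_def power2_norm_eq_inner) (simp add: power2_eq_square)

lemma mink_self_eq_0_iff: "mink v v = 0 \<longleftrightarrow> norm (fst v) = \<bar>snd v\<bar>"
  using norm_ge_zero[of "fst v"] by (simp add: mink_self power2_eq_iff del: norm_ge_zero) linarith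

lemma mink_self_le_0_iff: "mink v v \<le> 0 \<longleftrightarrow> norm (fst v) \<le> \<bar>snd v\<bar>"
  by (simp add: mink_self abs_le_square_iff[symmetric])

lemma mink_time_dir: "mink v time_dir = - snd v"
  by (simp add: mink_def time_dir_def)

lemma causal_le_iff: "causal_le p q \<longleftrightarrow> q - p \<in> causal_cone"
proof -
  have "v = 0 \<or> future_causal v \<longleftrightarrow> v \<in> causal_cone" for v :: "'a spacetime"
  proof (cases "snd v > 0")
    case True
    then show ?thesis
      by (auto simp: future_causal_def causal_vec_def causal_cone_def mink_self_le_0_iff)
  next
    case False
    then have "v \<in> causal_cone \<longleftrightarrow> v = 0"
      unfolding causal_cone_def
      by (smt (verit, best) mem_Collect_eq norm_ge_zero norm_eq_zero prod_eq_iff fst_zero snd_zero)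
    with False show ?thesis
      by (auto simp: future_causal_def)
  qed
  then show ?thesis unfolding causal_le_def by this
qed

lemma causal_cone_or_uminus:
  "v \<in> causal_cone \<or> - v \<in> causal_cone \<longleftrightarrow> mink v v \<le> 0"
  by (auto simp: causal_cone_def mink_self_le_0_iff)

lemma causal_cone_pointed: "v \<in> causal_cone \<Longrightarrow> - v \<in> causal_cone \<Longrightarrow> v = 0"
  unfolding causal_cone_def
  by (smt (verit) mem_Collect_eq norm_ge_zero norm_eq_zero prod_eq_iff fst_zero snd_zero snd_uminus)

lemma mink_causal_cone_le_0:
  assumes "u \<in> causal_cone" "v \<in> causal_cone"
  shows "mink u v \<le> 0"
proof -
  have "fst u \<bullet> fst v \<le> norm (fst u) * norm (fst v)"
    by (rule norm_cauchy_schwarz)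
  also have "\<dots> \<le> snd u * snd v"
    using assms by (intro mult_mono) (auto simp: causal_cone_def intro: order_trans[OF norm_ge_zero])
  finally show ?thesis by (simp add: mink_def)
qed

text \<open>One test vector suffices: the time axis if \<open>v\<close> has no spatial part,
  otherwise the null vector with the same spatial part as \<open>v\<close>.\<close>

lemma causal_cone_self_dual:
  assumes "\<And>w. w \<in> causal_cone \<Longrightarrow> mink v w \<le> 0"
  shows "v \<in> causal_cone"
proof (cases "fst v = 0")
  case True
  have "mink v (0, 1) \<le> 0"
    by (rule assms) (simp add: causal_cone_def)
  with True show ?thesis by (simp add: mink_def causal_cone_def)
next
  case False
  have "mink v (fst v, norm (fst v)) \<le> 0"
    by (rule assms) (simp add: causal_cone_def)
  then have "norm (fst v) * norm (fst v) \<le> snd v * norm (fst v)"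
    by (simp add: mink_def power2_eq_square flip: power2_norm_eq_inner)
  with False show ?thesis by (simp add: causal_cone_def)
qed

text \<open>This is the equality case of Cauchy-Schwarz: the three conditions give all inner
  products of the spatial parts, and the difference of the rescaled ones has norm zero.\<close>

lemma null_orthogonal_imp_parallel:
  assumes "mink u u = 0" "mink v v = 0" "mink u v = 0" "u \<noteq> 0"
  obtains c where "v = c *\<^sub>R u"
proof
  let ?c = "snd v / snd u"
  from assms(1,4) have "snd u \<noteq> 0"
    by (auto simp: mink_self_eq_0_iff prod_eq_iff)
  have "fst u \<bullet> fst u = snd u * snd u" "fst v \<bullet> fst v = snd v * snd v" "fst u \<bullet> fst v = snd u * snd v"
    using assms(1-3) by (simp_all add: mink_def)
  then have "(fst v - ?c *\<^sub>R fst u) \<bullet> (fst v - ?c *\<^sub>R fst u) = 0"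
    using \<open>snd u \<noteq> 0\<close> by (simp add: algebra_simps inner_commute[of "fst v" "fst u"])
  with \<open>snd u \<noteq> 0\<close> show "v = ?c *\<^sub>R u"
    by (simp add: prod_eq_iff)
qed

section \<open>Conformal linear maps\<close>

text \<open>Along \<open>(a, s)\<close> the form \<open>mink (M v) (M v)\<close> is a quadratic
  polynomial in \<open>s\<close> that vanishes at both \<open>norm a\<close> and
  \<open>- norm a\<close>. This kills the mixed term and fixes the ratio of the others.\<close>

lemma linear_null_imp_conformal:
  fixes M :: "'n::finite spacetime \<Rightarrow> 'n spacetime"
  assumes M: "linear M" and null: "\<And>v. mink v v = 0 \<Longrightarrow> mink (M v) (M v) = 0"
  obtains k where "\<And>u v. mink (M u) (M v) = k * mink u v"
proof
  \<comment> \<open>\<open>time_dir\<close> has Minkowski square -1, so no other factor is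
    possible.\<close>
  define k where "k = - mink (M time_dir) (M time_dir)"
  have self: "mink (M v) (M v) = k * mink v v" for v
  proof -
    obtain a s where v: "v = (a, s)" by fastforce
    let ?A = "M (a, 0)" and ?T = "M time_dir"
    have split: "M (a, s) = ?A + s *\<^sub>R ?T" for s
    proof -
      have "M (a, s) = M ((a, 0) + s *\<^sub>R time_dir)"
        by (simp add: time_dir_def)
      then show ?thesis
        by (simp only: linear_add[OF M] linear_scale[OF M])
    qed
    have e: "mink (M (a, s)) (M (a, s)) = mink ?A ?A + 2 * s * mink ?A ?T + s * s * mink ?T ?T" for s
      by (subst (1 2) split) (simp add: mink_simps mink_commute[of ?T ?A] distrib_left)
    have "mink (M (a, norm a)) (M (a, norm a)) = 0" "mink (M (a, - norm a)) (M (a, - norm a)) = 0"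
      by (rule null, simp add: mink_self_eq_0_iff)+
    with e[of "norm a"] e[of "- norm a"] have "mink ?A ?A + 2 * norm a * mink ?A ?T + norm a * norm a * mink ?T ?T = 0"
      "mink ?A ?A + 2 * - norm a * mink ?A ?T + - norm a * - norm a * mink ?T ?T = 0"
      by linarith+
    then have A: "mink ?A ?A = k * (norm a)\<^sup>2" and AT: "norm a * mink ?A ?T = 0"
      unfolding k_def power2_eq_square by (simp_all only: mult_minus_left mult_minus_right) argo+
    have "mink ?A ?T = 0"
    proof (cases "a = 0")
      case True
      then have "(a, 0) = (0 :: 'n spacetime)"
        by (simp add: zero_prod_def)
      then show ?thesis by (simp only: linear_0[OF M] mink_simps)
    qed (use AT in simp)
    with A e[of s] have "mink (M (a, s)) (M (a, s)) = k * (norm a)\<^sup>2 + s * s * - k"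
      by (simp add: k_def)
    also have "\<dots> = k * mink (a, s) (a, s)"
      by (simp add: mink_self algebra_simps power2_eq_square)
    finally show ?thesis by (simp only: v)
  qed
  fix u v
  \<comment> \<open>Polarisation passes from the quadratic form to the bilinear form.\<close>
  have "mink (M u) (M u) + 2 * mink (M u) (M v) + mink (M v) (M v)
      = k * (mink u u + 2 * mink u v + mink v v)"
    using self[of "u + v"]
    by (simp only: linear_add[OF M] mink_simps mink_commute[of "M v" "M u"] mink_commute[of v u])
      (simp add: algebra_simps)
  then show "mink (M u) (M v) = k * mink u v"
    by (simp add: self distrib_left)
qed

text \<open>Conformality says that the Minkowski adjoint \<open>?X\<close> satisfies
  \<open>?X (M w) = k *\<^sub>R w\<close>. As \<open>k\<close> is nonzero, \<open>M\<close> is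
  invertible and the two factors may be exchanged, which is conformality of the adjoint.\<close>

lemma adjoint_conformal:
  fixes M :: "'n::finite spacetime \<Rightarrow> 'n spacetime"
  assumes M: "linear M" and conf: "\<And>u v. mink (M u) (M v) = k * mink u v" and "k \<noteq> 0"
  shows "mink (adjoint M u) (adjoint M v) = k * mink u v"
proof -
  let ?X = "\<lambda>w. time_reflection (adjoint M (time_reflection w))"
  have X: "?X (M w) = k *\<^sub>R w" for w
  proof -
    have "u \<bullet> ?X (M w) = u \<bullet> (k *\<^sub>R w)" for u
    proof -
      have "u \<bullet> ?X (M w) = M (time_reflection u) \<bullet> time_reflection (M w)"
        by (simp add: adjoint_works[OF M] flip: time_reflection_inner)
      also have "\<dots> = k * (u \<bullet> w)"
        using conf[of "time_reflection u" w] by (simp add: mink_eq_inner time_reflection_inner)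
      finally show ?thesis by simp
    qed
    then show ?thesis by (metis vector_eq_rdot inner_commute)
  qed
  have "inj M"
    using X \<open>k \<noteq> 0\<close> by (metis injI scaleR_left_imp_eq)
  then have "surj M"
    by (rule linear_inj_imp_surj[OF M])
  have MX: "M (?X w) = k *\<^sub>R w" for w
  proof -
    obtain z where "w = M z" using \<open>surj M\<close> by blast
    then show ?thesis using X by (simp add: linear_scale[OF M])
  qed
  have "mink (adjoint M u) (adjoint M v) = M (?X (time_reflection v)) \<bullet> u"
    by (simp add: mink_eq_inner adjoint_works[OF M] inner_commute[of "adjoint M u"])
  then show ?thesis
    using MX[of "time_reflection v"] by (simp add: mink_eq_inner inner_commute)
qed

section \<open>Causal automorphisms are affine\<close>

text \<open>The expansion of \<open>mink (u + v) (u + v)\<close> has only nonpositive terms, so all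
  vanish. Then \<open>u\<close> is null and orthogonal to the null vector \<open>u + v\<close>,
  hence parallel to it.\<close>

lemma null_sum_in_causal_cone:
  assumes "u \<in> causal_cone" "v \<in> causal_cone" "mink (u + v) (u + v) = 0"
  obtains c where "u = c *\<^sub>R (u + v)"
proof (cases "u + v = 0")
  case True
  then have "v = - u" by (simp add: add_eq_0_iff)
  with assms causal_cone_pointed[of u] have "u = 0 *\<^sub>R (u + v)" by simp
  then show thesis by (rule that)
next
  case False
  have "mink u u \<le> 0" "mink v v \<le> 0" "mink u v \<le> 0"
    using assms by (simp_all add: mink_causal_cone_le_0)
  moreover have "mink u u + 2 * mink u v + mink v v = 0"
    using assms(3) by (simp add: mink_simps mink_commute[of v u])
  ultimately have "mink u u = 0" "mink u v = 0" by linarith+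
  then have "mink (u + v) u = 0"
    by (simp add: mink_simps mink_commute[of v u])
  from null_orthogonal_imp_parallel[OF assms(3) \<open>mink u u = 0\<close> this False] that
  show thesis by blast
qed

text \<open>If \<open>q - p\<close> is null, the interval lies on the segment from \<open>p\<close>
  to \<open>q\<close>, whose points are comparable. If not, the midpoint can be moved sideways
  within the interval to an incomparable point.\<close>

lemma null_iff_causal_interval_chain:
  assumes "causal_le p q"
  shows "mink (q - p) (q - p) = 0 \<longleftrightarrow>
    (\<forall>r s. causal_le p r \<and> causal_le r q \<and> causal_le p s \<and> causal_le s q
      \<longrightarrow> causal_le r s \<or> causal_le s r)"
proof
  assume null: "mink (q - p) (q - p) = 0"
  have on_segment: "\<exists>c. r = p + c *\<^sub>R (q - p)" if r: "causal_le p r" "causal_le r q" for r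
  proof -
    have sum: "(r - p) + (q - r) = q - p" by simp
    obtain c where "r - p = c *\<^sub>R (q - p)"
      using null_sum_in_causal_cone[of "r - p" "q - r"] null r
      unfolding causal_le_iff sum by blast
    then have "r = p + c *\<^sub>R (q - p)" by (simp add: algebra_simps)
    then show ?thesis ..
  qed
  show "\<forall>r s. causal_le p r \<and> causal_le r q \<and> causal_le p s \<and> causal_le s q
      \<longrightarrow> causal_le r s \<or> causal_le s r"
  proof (intro allI impI, elim conjE)
    fix r s
    assume "causal_le p r" "causal_le r q" "causal_le p s" "causal_le s q"
    then obtain b c where "r = p + b *\<^sub>R (q - p)" "s = p + c *\<^sub>R (q - p)"
      using on_segment by meson
    then have diff: "s - r = (c - b) *\<^sub>R (q - p)" "r - s = - ((c - b) *\<^sub>R (q - p))"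
      by (simp_all add: scaleR_left_diff_distrib)
    show "causal_le r s \<or> causal_le s r"
      unfolding causal_le_iff diff causal_cone_or_uminus by (simp add: mink_simps(5,6) null)
  qed
next
  assume chain: "\<forall>r s. causal_le p r \<and> causal_le r q \<and> causal_le p s \<and> causal_le s q
      \<longrightarrow> causal_le r s \<or> causal_le s r"
  define v where "v = q - p"
  \<comment> \<open>Half of the slack of \<open>v\<close> in the cone: the midpoint may be shifted
    this far in a spatial direction without leaving the interval. The index \<open>undefined\<close>
    stands for an arbitrary axis.\<close>
  define e where "e = (snd v - norm (fst v)) / 2"
  have "norm (fst v) \<le> snd v"
    using assms by (simp add: causal_le_iff causal_cone_def v_def)
  then have "0 \<le> e" by (simp add: e_def)
  define m r where "m = p + (1/2) *\<^sub>R v" and "r = m + e *\<^sub>R space_dir undefined"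
  have half: "norm ((1/2) *\<^sub>R fst v + d *\<^sub>R axis undefined 1) \<le> snd v / 2" if "\<bar>d\<bar> \<le> e" for d
  proof -
    have "norm ((1/2) *\<^sub>R fst v + d *\<^sub>R axis undefined 1) \<le> norm (fst v) / 2 + \<bar>d\<bar>"
      by (rule order_trans[OF norm_triangle_ineq]) (simp add: norm_axis_1)
    with that show ?thesis by (simp add: e_def field_simps)
  qed
  have diffs: "m - p = (1/2) *\<^sub>R v" "q - m = (1/2) *\<^sub>R v" "r - p = (1/2) *\<^sub>R v + e *\<^sub>R space_dir undefined"
    "q - r = (1/2) *\<^sub>R v + (- e) *\<^sub>R space_dir undefined"
    by (simp_all add: m_def r_def v_def algebra_simps flip: scaleR_left.add)
  have "causal_le p m" "causal_le m q" "causal_le p r" "causal_le r q"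
    using half[of 0] half[of e] half[of "- e"] \<open>0 \<le> e\<close>
    by (simp_all add: causal_le_iff causal_cone_def diffs space_dir_def del: norm_scaleR)
  with chain have "causal_le m r \<or> causal_le r m" by blast
  then have "e = 0"
    using \<open>0 \<le> e\<close> by (auto simp: causal_le_iff causal_cone_def r_def space_dir_def norm_axis_1)
  then show "mink (q - p) (q - p) = 0"
    by (simp add: mink_self_eq_0_iff e_def flip: v_def)
qed

lemma causal_automorphism_inv:
  assumes "causal_automorphism F"
  shows "causal_automorphism (inv F)"
proof -
  have "bij F" using assms by (simp add: causal_automorphism_def)
  then have "F (inv F p) = p" for p by (simp add: bij_is_surj surj_f_inv_f)
  with assms \<open>bij F\<close> show ?thesis
    by (metis causal_automorphism_def bij_imp_bij_inv)
qed

text \<open>The chain criterion involves the order alone, so it is preserved. It needs comparable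
  endpoints, but null separated points are comparable in one of the two directions, before and after
  \<open>F\<close>.\<close>

lemma causal_automorphism_null:
  assumes "causal_automorphism F"
  shows "mink (F q - F p) (F q - F p) = 0 \<longleftrightarrow> mink (q - p) (q - p) = 0"
proof -
  have le: "causal_le (F p) (F q) \<longleftrightarrow> causal_le p q" for p q
    using assms by (simp only: causal_automorphism_def)
  have surj: "(\<forall>r. P r) \<longleftrightarrow> (\<forall>r. P (F r))" for P
    using assms by (metis causal_automorphism_def bij_is_surj surj_f_inv_f)
  have future: "mink (F q - F p) (F q - F p) = 0 \<longleftrightarrow> mink (q - p) (q - p) = 0"
    if "causal_le p q" for p q
  proof -
    have "causal_le (F p) (F q)" using that le by simp
    then have "mink (F q - F p) (F q - F p) = 0 \<longleftrightarrow>
      (\<forall>r s. causal_le (F p) r \<and> causal_le r (F q) \<and> causal_le (F p) s \<and> causal_le s (F q)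
      \<longrightarrow> causal_le r s \<or> causal_le s r)" by (rule null_iff_causal_interval_chain)
    also have "\<dots> \<longleftrightarrow> (\<forall>r s. causal_le (F p) (F r) \<and> causal_le (F r) (F q) \<and> causal_le (F p) (F s) \<and> causal_le (F s) (F q)
      \<longrightarrow> causal_le (F r) (F s) \<or> causal_le (F s) (F r))"
      by (subst surj, rule all_cong1, subst surj, rule refl)
    also have "\<dots> \<longleftrightarrow> mink (q - p) (q - p) = 0"
      unfolding le null_iff_causal_interval_chain[OF that] by (rule refl)
    finally show ?thesis .
  qed
  have swap: "mink (a - b) (a - b) = mink (b - a) (b - a)" for a b :: "'a spacetime"
    by (simp add: mink_simps)
  have comparable: "causal_le a b \<or> causal_le b a" if "mink (b - a) (b - a) = 0" for a b :: "'a spacetime"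
    using causal_cone_or_uminus[of "b - a"] that by (simp add: causal_le_iff)
  show ?thesis
    using future[of p q] future[of q p] swap comparable[of p q] comparable[of "F p" "F q"] le
    by metis
qed

section \<open>Images of null lines\<close>

text \<open>Points of a null line are pairwise null separated, and so are their images. Two null
  vectors with null difference are orthogonal, hence parallel. No regularity of the parameter change
  \<open>g\<close> is claimed beyond bijectivity.\<close>

lemma causal_automorphism_null_line:
  fixes F :: "'n::finite spacetime \<Rightarrow> 'n spacetime"
  assumes F: "causal_automorphism F" and v: "mink v v = 0" "v \<noteq> 0"
  obtains g w where "bij g" "mink w w = 0" "w \<noteq> 0" "\<And>t. F (p + t *\<^sub>R v) = F p + g t *\<^sub>R w"
proof -
  \<comment> \<open>Stated for any automorphism \<open>G\<close>, because the inverse of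
    \<open>F\<close> is used below to show that \<open>g\<close> is surjective.\<close>
  have on_line: "\<exists>c. G (a + x) = G a + c *\<^sub>R (G (a + u) - G a)"
    if G: "causal_automorphism G" and "mink u u = 0" "u \<noteq> 0" "x = t *\<^sub>R u"
    for G :: "'n spacetime \<Rightarrow> 'n spacetime" and a u x t
  proof -
    note null = causal_automorphism_null[OF G]
    let ?w = "G (a + u) - G a" and ?b = "G (a + x) - G a"
    have "?w \<noteq> 0"
      using G \<open>u \<noteq> 0\<close> by (auto simp: causal_automorphism_def bij_def inj_eq)
    have w: "mink ?w ?w = 0" and b: "mink ?b ?b = 0"
      unfolding null using that by (simp_all add: mink_simps)
    have "mink (G (a + x) - G (a + u)) (G (a + x) - G (a + u)) = 0"
      unfolding null using that by (simp add: mink_simps)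
    then have "mink (?b - ?w) (?b - ?w) = 0" by simp
    moreover have "mink (y - z) (y - z) = mink y y - 2 * mink z y + mink z z" for y z :: "'n spacetime"
      by (simp add: mink_simps mink_commute[of y z])
    ultimately have "mink ?w ?b = 0"
      using w b by (metis diff_zero mult_eq_0_iff neg_equal_0_iff_equal add.right_neutral diff_0 zero_neq_numeral)
    from null_orthogonal_imp_parallel[OF w b this \<open>?w \<noteq> 0\<close>]
    show ?thesis by (metis add.commute diff_add_cancel)
  qed
  define w where "w = F (p + v) - F p"
  obtain g where g: "F (p + t *\<^sub>R v) = F p + g t *\<^sub>R w" for t
    using on_line[OF F v refl, of p] unfolding w_def by metis
  have "bij F" using F by (simp add: causal_automorphism_def)
  then have inv: "inv F (F x) = x" "F (inv F x) = x" for x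
    by (simp_all add: bij_is_inj bij_is_surj surj_f_inv_f)
  have w: "mink w w = 0" "w \<noteq> 0"
    using v \<open>bij F\<close> causal_automorphism_null[OF F, of "p + v" p] by (auto simp: w_def bij_def inj_eq)
  have "inj g"
  proof (rule injI)
    fix s t assume "g s = g t"
    then have "F (p + s *\<^sub>R v) = F (p + t *\<^sub>R v)" by (simp add: g)
    with \<open>bij F\<close> v show "s = t" by (simp add: bij_def inj_eq)
  qed
  moreover have "surj g"
    unfolding surj_def
  proof
    fix c
    obtain t where "inv F (F p + c *\<^sub>R w) = p + t *\<^sub>R v"
      using on_line[OF causal_automorphism_inv[OF F] w refl, of "F p" c] by (auto simp: w_def inv)
    then have "F p + c *\<^sub>R w = F p + g t *\<^sub>R w" by (metis g inv(2))
    with w show "\<exists>t. c = g t" by auto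
  qed
  ultimately show thesis using that w g by (blast intro: bijI)
qed

text \<open>The points at parameters \<open>t\<close> and \<open>s\<close> on the parallel null lines through \<open>p\<close> and \<open>p + u\<close>
  are null separated iff \<open>s = t\<close>. On the image lines, null separation is the relation \<open>E = 0\<close>
  below, which is the graph of a bijection only if the image lines are parallel.\<close>

lemma causal_automorphism_parallelogram:
  fixes F :: "'n::finite spacetime \<Rightarrow> 'n spacetime"
  assumes F: "causal_automorphism F"
    and u: "mink u u = 0" and v: "mink v v = 0" and uv: "mink u v \<noteq> 0"
  shows "F (p + u + v) - F (p + u) = F (p + v) - F p"
proof -
  have "v \<noteq> 0" using uv by (auto simp: mink_simps)
  obtain g w where g: "bij g" and w: "mink w w = 0" "w \<noteq> 0"
    and Fg: "\<And>t. F (p + t *\<^sub>R v) = F p + g t *\<^sub>R w"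
    using causal_automorphism_null_line[OF F v \<open>v \<noteq> 0\<close>] by metis
  obtain h z where h: "bij h" and z: "mink z z = 0" "z \<noteq> 0"
    and Fh: "\<And>t. F (p + u + t *\<^sub>R v) = F (p + u) + h t *\<^sub>R z"
    using causal_automorphism_null_line[OF F v \<open>v \<noteq> 0\<close>] by metis
  define D where "D = F (p + u) - F p"
  have D: "mink D D = 0"
    using causal_automorphism_null[OF F, of "p + u" p] u by (simp add: D_def)
  \<comment> \<open>Half the Minkowski square of the difference of two points on the image lines;
    the square terms drop out as \<open>D\<close>, \<open>w\<close> and \<open>z\<close> are
    null.\<close>
  define E where "E s t = s * mink D z - t * mink D w - s * t * mink w z" for s t
  have E: "E (h s) (g t) = 0 \<longleftrightarrow> s = t" for s t
  proof -
    have "F (p + u + s *\<^sub>R v) - F (p + t *\<^sub>R v) = D + h s *\<^sub>R z - g t *\<^sub>R w"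
      by (simp add: Fg Fh D_def)
    moreover have "p + u + s *\<^sub>R v - (p + t *\<^sub>R v) = u + (s - t) *\<^sub>R v"
      by (simp add: algebra_simps)
    ultimately have "mink (D + h s *\<^sub>R z - g t *\<^sub>R w) (D + h s *\<^sub>R z - g t *\<^sub>R w) = 0
        \<longleftrightarrow> mink (u + (s - t) *\<^sub>R v) (u + (s - t) *\<^sub>R v) = 0"
      using causal_automorphism_null[OF F, of "p + u + s *\<^sub>R v" "p + t *\<^sub>R v"] by (simp only:)
    moreover have "mink (D + h s *\<^sub>R z - g t *\<^sub>R w) (D + h s *\<^sub>R z - g t *\<^sub>R w) = 2 * E (h s) (g t)"
      by (simp add: mink_simps D w z E_def mink_commute[of z D] mink_commute[of w D]
          mink_commute[of z w] algebra_simps)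
    moreover have "mink (u + (s - t) *\<^sub>R v) (u + (s - t) *\<^sub>R v) = 2 * ((s - t) * mink u v)"
      by (simp add: mink_simps u v mink_commute[of v u])
    ultimately show ?thesis using uv by simp
  qed
  have wz: "mink w z = 0"
  proof (rule ccontr)
    assume wz: "mink w z \<noteq> 0"
    \<comment> \<open>At this \<open>t\<close> the terms of \<open>E\<close> that contain its first
      argument cancel, so one zero forces \<open>E\<close> to vanish for every first argument,
      against uniqueness of the partner.\<close>
    define t where "t = inv g (mink D z / mink w z)"
    have "g t = mink D z / mink w z"
      using g by (simp add: t_def bij_is_surj surj_f_inv_f)
    then have "E s (g t) = - g t * mink D w" for s
      using wz by (simp add: E_def)
    then have "E (h (t + 1)) (g t) = 0"
      using E[of t t] by simp
    then show False by (simp add: E)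
  qed
  then obtain c where c: "z = c *\<^sub>R w"
    using null_orthogonal_imp_parallel w z by metis
  have "mink D w \<noteq> 0"
  proof
    assume "mink D w = 0"
    then have "E (h 0) (g 1) = 0" by (simp add: E_def c mink_simps w)
    then show False by (simp add: E)
  qed
  moreover have "(h 1 * c - g 1) * mink D w = 0"
    using E[of 1 1] by (simp add: E_def c mink_simps w algebra_simps)
  ultimately have "h 1 *\<^sub>R z = g 1 *\<^sub>R w" by (simp add: c)
  then show ?thesis using Fg[of 1] Fh[of 1] by simp
qed

section \<open>Additive generation by null vectors\<close>

text \<open>Closure under addition suffices, because multiples of null vectors are null. Spatial and
  time vectors are each a sum of two null vectors.\<close>

lemma null_span:
  fixes P :: "'n::finite spacetime \<Rightarrow> bool"
  assumes null: "\<And>u. mink u u = 0 \<Longrightarrow> P u" and add: "\<And>u v. P u \<Longrightarrow> P v \<Longrightarrow> P (u + v)"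
  shows "P x"
proof -
  obtain a s where x: "x = (a, s)" by fastforce
  have space: "P (a, 0)"
  proof -
    have "P ((1/2) *\<^sub>R (a, norm a) + (1/2) *\<^sub>R (a, - norm a))"
      by (intro add null) (simp_all add: mink_simps mink_self_eq_0_iff)
    then show ?thesis by (simp flip: scaleR_left.add)
  qed
  have "P ((1/2) *\<^sub>R (s *\<^sub>R axis undefined 1, s) + (1/2) *\<^sub>R (- s *\<^sub>R axis undefined 1, s))"
    by (intro add null) (simp_all add: mink_simps mink_self_eq_0_iff norm_axis_1)
  then have "P (0, s)" by (simp flip: scaleR_left.add)
  from add[OF space this] show ?thesis by (simp add: x)
qed

text \<open>Only null vectors parallel to \<open>v\<close> need work; the second spatial dimension
  lets them be decomposed into null vectors off that line.\<close>

lemma nonorthogonal_null_span: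
  fixes P :: "'n::finite spacetime \<Rightarrow> bool"
  assumes dim: "CARD('n) \<ge> 2" and v: "mink v v = 0" "v \<noteq> 0"
    and null: "\<And>u. mink u u = 0 \<Longrightarrow> mink u v \<noteq> 0 \<Longrightarrow> P u" and "P 0"
    and add: "\<And>u v. P u \<Longrightarrow> P v \<Longrightarrow> P (u + v)"
  shows "P x"
proof (rule null_span[of P, OF _ add])
  fix u :: "'n spacetime" assume u: "mink u u = 0"
  show "P u"
  proof (cases "mink v u = 0")
    case False
    then show ?thesis using null u by (simp add: mink_commute)
  next
    case True
    show ?thesis
    proof (cases "u = 0")
      case True
      then show ?thesis using \<open>P 0\<close> by simp
    next
      case False
      obtain c where c: "u = c *\<^sub>R v"
        using null_orthogonal_imp_parallel[OF v(1) u True v(2)] by blast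
      obtain a s where as: "u = (a, s)" by fastforce
      have "norm a = \<bar>s\<bar>" using u by (simp add: as mink_self_eq_0_iff)
      with False have "s \<noteq> 0" by (auto simp: as zero_prod_def)
      obtain b' where "b' \<noteq> 0" "orthogonal a b'"
        using orthogonal_to_vector_exists[of a] dim by (auto simp: DIM_cart)
      define b where "b = (\<bar>s\<bar> / norm b') *\<^sub>R b'"
      have b: "norm b = \<bar>s\<bar>" "a \<bullet> b = 0"
        using \<open>b' \<noteq> 0\<close> \<open>orthogonal a b'\<close> by (simp_all add: b_def orthogonal_def)
      have c': "mink y v \<noteq> 0" if "mink y u \<noteq> 0" for y
        using that by (auto simp: c mink_simps)
      \<comment> \<open>The sum is \<open>(a, s)\<close>. Each summand is null, and its product with
        \<open>u\<close> is a nonzero multiple of the square of \<open>s\<close>.\<close>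
      have "P ((b, s) + (- b, s) + (a, - s))"
        using \<open>s \<noteq> 0\<close> \<open>norm a = \<bar>s\<bar>\<close> b
        by (intro add null c')
          (auto simp: mink_self_eq_0_iff, auto simp: as mink_def inner_commute[of b a] dot_square_norm power2_eq_square)
      then show ?thesis by (simp add: as)
    qed
  qed
qed

text \<open>Zeeman's theorem, up to the continuity that makes an additive map linear.\<close>

lemma causal_automorphism_additive:
  fixes F :: "'n::finite spacetime \<Rightarrow> 'n spacetime"
  assumes F: "causal_automorphism F" and dim: "CARD('n) \<ge> 2"
  shows "F (x + y) = F x + F y - F 0"
proof -
  have "\<forall>x. F (x + y) = F x + F y - F 0"
  proof (rule null_span[where P = "\<lambda>y. \<forall>x. F (x + y) = F x + F y - F 0" and x = y])
    fix v :: "'n spacetime" assume v: "mink v v = 0"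
    show "\<forall>x. F (x + v) = F x + F v - F 0"
    proof (cases "v = 0")
      case False
      \<comment> \<open>For fixed null \<open>v\<close>, the property says that shifting by
        \<open>x\<close> does not change the displacement caused by \<open>v\<close>. Quantifying
        over \<open>p\<close> makes it closed under addition in \<open>x\<close>, and the
        parallelogram lemma supplies the generators.\<close>
      have "\<forall>p. F (p + x + v) - F (p + x) = F (p + v) - F p" for x
      proof (rule nonorthogonal_null_span[where P = "\<lambda>x. \<forall>p. F (p + x + v) - F (p + x) = F (p + v) - F p",
            OF dim v False])
        fix a b
        assume a: "\<forall>p. F (p + a + v) - F (p + a) = F (p + v) - F p"
          and b: "\<forall>p. F (p + b + v) - F (p + b) = F (p + v) - F p"
        show "\<forall>p. F (p + (a + b) + v) - F (p + (a + b)) = F (p + v) - F p"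
        proof
          fix p
          show "F (p + (a + b) + v) - F (p + (a + b)) = F (p + v) - F p"
            using spec[OF a, of p] spec[OF b, of "p + a"] by (simp add: add.assoc)
        qed
      qed (use causal_automorphism_parallelogram[OF F _ v] in \<open>auto simp del: split_paired_All\<close>)
      from spec[OF this, of 0] have "F (x + v) - F x = F v - F 0" for x by simp
      then have "F (x + v) = F x + F v - F 0" for x
        by (metis add_diff_eq add.commute diff_eq_eq)
      then show ?thesis by blast
    qed simp
  next
    fix a b
    assume a: "\<forall>x. F (x + a) = F x + F a - F 0" and b: "\<forall>x. F (x + b) = F x + F b - F 0"
    show "\<forall>x. F (x + (a + b)) = F x + F (a + b) - F 0"
    proof
      fix x
      show "F (x + (a + b)) = F x + F (a + b) - F 0"
        using spec[OF a, of x] spec[OF b, of "x + a"] spec[OF b, of a] by (simp add: add.assoc)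
    qed
  qed
  then show ?thesis by blast
qed

text \<open>Additivity makes the derivative the same at every point; \<open>F\<close> minus this
  linear map has zero derivative and is constant.\<close>

lemma causal_automorphism_affine:
  fixes F :: "'n::finite spacetime \<Rightarrow> 'n spacetime"
  assumes F: "causal_automorphism F" and dim: "CARD('n) \<ge> 2"
    and diff: "\<And>x. F differentiable (at x)"
  obtains L where "linear L" "\<And>x. F x = F 0 + L x"
proof -
  obtain F' where F': "(F has_derivative F' x) (at x)" for x
    using diff unfolding differentiable_def by metis
  have const: "F' y = F' 0" for y
  proof (rule has_derivative_unique)
    have "((\<lambda>x. F (x + y)) has_derivative F' 0) (at 0)"
      unfolding causal_automorphism_additive[OF F dim, of _ y]
      by (auto intro!: derivative_eq_intros F')
    then have "((\<lambda>x. F (x + y) ) \<circ> (\<lambda>x. x - y) has_derivative F' 0 \<circ> (\<lambda>x. x)) (at y)"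
      by (intro diff_chain_at) (auto intro!: derivative_eq_intros)
    then show "(F has_derivative F' 0) (at y)"
      by (simp add: o_def)
  qed (rule F')
  have lin: "linear (F' 0)"
    using F' has_derivative_linear by blast
  have "((\<lambda>x. F x - F' 0 x) has_derivative (\<lambda>x. 0)) (at y)" for y
    using has_derivative_diff[OF F'[of y] bounded_linear_imp_has_derivative[OF has_derivative_bounded_linear[OF F'[of 0]]]]
    by (simp add: const[of y])
  then obtain c where c: "F x - F' 0 x = c" for x
    using has_derivative_zero_constant[of UNIV "\<lambda>x. F x - F' 0 x"] by auto
  have "F x = F 0 + F' 0 x" for x
    using c[of x] c[of 0] linear_0[OF lin] by (simp add: algebra_simps)
  with lin show thesis by (rule that)
qed

section \<open>Smooth functions and the wave operator\<close>

text \<open>The head of the list is the outermost derivative, so the last direction is the one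
  differentiated first.\<close>

lemma iter_dderiv_snoc: "iter_dderiv f (vs @ [v]) = iter_dderiv (iter_dderiv f [v]) vs"
  by (induction vs) simp_all

lemma smooth_imp_differentiable: "smooth f \<Longrightarrow> f differentiable (at x)"
  using iter_dderiv.simps(1)[of f] unfolding smooth_def by metis

lemma smooth_has_derivative: "smooth f \<Longrightarrow> (f has_derivative frechet_derivative f (at x)) (at x)"
  by (simp add: smooth_imp_differentiable flip: frechet_derivative_works)

lemma smooth_iter_dderiv: "smooth f \<Longrightarrow> smooth (iter_dderiv f [v])"
  unfolding smooth_def iter_dderiv_snoc[symmetric] by blast

lemma smooth_frechet_derivative: "smooth f \<Longrightarrow> smooth (\<lambda>x. frechet_derivative f (at x) v)"
  using smooth_iter_dderiv[of f v] by simp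

text \<open>Smoothness follows from membership in any class of differentiable functions that is
  closed under directional derivatives.\<close>

lemma smooth_coinduct [consumes 1, case_names differentiable derivative]:
  assumes "P f" and diff: "\<And>f x. P f \<Longrightarrow> f differentiable (at x)"
    and deriv: "\<And>f v. P f \<Longrightarrow> P (\<lambda>x. frechet_derivative f (at x) v)"
  shows "smooth f"
proof -
  have "P (iter_dderiv f vs)" for vs
    by (induction vs) (simp_all add: \<open>P f\<close> deriv)
  with diff show ?thesis by (simp add: smooth_def)
qed

lemma frechet_derivative_eqI: "(f has_derivative D) (at x) \<Longrightarrow> frechet_derivative f (at x) = D"
  by (rule frechet_derivative_at[symmetric])

lemma frechet_derivative_bounded_linear:
  assumes "bounded_linear T" "f differentiable (at x)"
  shows "frechet_derivative (\<lambda>x. T (f x)) (at x) v = T (frechet_derivative f (at x) v)"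
proof -
  have "((\<lambda>x. T (f x)) has_derivative (\<lambda>v. T (frechet_derivative f (at x) v))) (at x)"
    by (rule bounded_linear.has_derivative[OF assms(1) frechet_derivative_works[THEN iffD1, OF assms(2)]])
  from frechet_derivative_eqI[OF this] show ?thesis by simp
qed

lemma smooth_bounded_linear:
  fixes f :: "'a::euclidean_space \<Rightarrow> 'b::real_normed_vector"
    and T :: "'b \<Rightarrow> 'c::real_normed_vector"
  assumes T: "bounded_linear T" and "smooth f"
  shows "smooth (\<lambda>x. T (f x))"
proof (rule smooth_coinduct[where P = "\<lambda>h. \<exists>g. smooth g \<and> h = (\<lambda>x. T (g x))"])
  fix h :: "'a \<Rightarrow> 'c" and x v
  assume "\<exists>g. smooth g \<and> h = (\<lambda>x. T (g x))"
  then obtain g where g: "smooth g" "h = (\<lambda>x. T (g x))" by blast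
  show "h differentiable (at x)"
    unfolding g(2) by (rule differentiableI, rule bounded_linear.has_derivative[OF T smooth_has_derivative[OF g(1)]])
  show "\<exists>g. smooth g \<and> (\<lambda>x. frechet_derivative h (at x) v) = (\<lambda>x. T (g x))"
    unfolding g(2) frechet_derivative_bounded_linear[OF T smooth_imp_differentiable[OF g(1)]]
    using smooth_frechet_derivative[OF g(1)] by blast
qed (rule exI[of _ f], simp add: \<open>smooth f\<close>)

text \<open>Products alone are not visibly closed under derivatives; by the Leibniz rule their
  finite sums are, which makes this the invariant for \<open>smooth_mult\<close>.\<close>

inductive sum_of_smooth_products :: "('a::euclidean_space \<Rightarrow> real) \<Rightarrow> bool" where
  mult: "smooth f \<Longrightarrow> smooth g \<Longrightarrow> sum_of_smooth_products (\<lambda>x. f x * g x)"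
| add: "sum_of_smooth_products f \<Longrightarrow> sum_of_smooth_products g \<Longrightarrow> sum_of_smooth_products (\<lambda>x. f x + g x)"

lemma frechet_derivative_add:
  assumes "f differentiable (at x)" "g differentiable (at x)"
  shows "frechet_derivative (\<lambda>x. f x + g x) (at x) v
    = frechet_derivative f (at x) v + frechet_derivative g (at x) v"
proof -
  have "((\<lambda>x. f x + g x) has_derivative
      (\<lambda>v. frechet_derivative f (at x) v + frechet_derivative g (at x) v)) (at x)"
    using assms by (intro has_derivative_add) (simp_all flip: frechet_derivative_works)
  from frechet_derivative_eqI[OF this] show ?thesis by simp
qed

lemma frechet_derivative_mult:
  fixes f g :: "'a::euclidean_space \<Rightarrow> real"
  assumes "f differentiable (at x)" "g differentiable (at x)"
  shows "frechet_derivative (\<lambda>x. f x * g x) (at x) v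
    = f x * frechet_derivative g (at x) v + frechet_derivative f (at x) v * g x"
proof -
  have "((\<lambda>x. f x * g x) has_derivative
      (\<lambda>v. f x * frechet_derivative g (at x) v + frechet_derivative f (at x) v * g x)) (at x)"
    using assms by (intro has_derivative_mult) (simp_all flip: frechet_derivative_works)
  from frechet_derivative_eqI[OF this] show ?thesis by simp
qed

lemma smooth_mult:
  fixes f g :: "'a::euclidean_space \<Rightarrow> real"
  assumes "smooth f" "smooth g"
  shows "smooth (\<lambda>x. f x * g x)"
proof (rule smooth_coinduct[where P = sum_of_smooth_products])
  have diff: "h differentiable (at x)" if "sum_of_smooth_products h" for h :: "'a \<Rightarrow> real" and x
    using that by induction (simp_all add: smooth_imp_differentiable)
  fix h :: "'a \<Rightarrow> real" and x v
  assume h: "sum_of_smooth_products h"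
  then show "h differentiable (at x)" by (rule diff)
  from h show "sum_of_smooth_products (\<lambda>x. frechet_derivative h (at x) v)"
  proof induction
    case (mult f g)
    then show ?case
      by (simp only: frechet_derivative_mult smooth_imp_differentiable)
        (intro sum_of_smooth_products.intros smooth_frechet_derivative)
  next
    case (add f g)
    then show ?case
      by (simp add: frechet_derivative_add diff sum_of_smooth_products.add)
  qed
qed (rule sum_of_smooth_products.mult[OF assms])

lemma iter_dderiv_square:
  fixes f :: "'a::euclidean_space \<Rightarrow> real"
  assumes "smooth f"
  shows "iter_dderiv (\<lambda>x. f x * f x) [v, v] x
    = 2 * (f x * iter_dderiv f [v, v] x + (frechet_derivative f (at x) v)\<^sup>2)"
proof -
  note f = smooth_imp_differentiable[OF assms] smooth_imp_differentiable[OF smooth_frechet_derivative[OF assms]]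
  have "frechet_derivative (\<lambda>x. f x * frechet_derivative f (at x) v + frechet_derivative f (at x) v * f x) (at x) v
     = 2 * (f x * iter_dderiv f [v, v] x + (frechet_derivative f (at x) v)\<^sup>2)"
    by (subst frechet_derivative_add)
      (auto intro!: derivative_intros f simp: frechet_derivative_mult f power2_eq_square algebra_simps)
  then show ?thesis by (simp add: frechet_derivative_mult f)
qed

text \<open>The inner map has constant derivative \<open>M\<close>, so the second chain rule
  produces no term with a second derivative of it.\<close>

lemma iter_dderiv_affine:
  assumes "smooth \<phi>" "bounded_linear M"
  shows "iter_dderiv (\<lambda>x. \<phi> (c + M x)) [u, v] x = iter_dderiv \<phi> [M u, M v] (c + M x)"
proof -
  have chain: "frechet_derivative (\<lambda>x. \<psi> (c + M x)) (at x) v = frechet_derivative \<psi> (at (c + M x)) (M v)"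
    if "smooth \<psi>" for \<psi> :: "'a \<Rightarrow> 'b" and x v
  proof -
    have "((\<lambda>x. c + M x) has_derivative M) (at x)"
      using bounded_linear_imp_has_derivative[OF assms(2)] by (auto intro!: derivative_eq_intros)
    from diff_chain_at[OF this smooth_has_derivative[OF that]]
    show ?thesis by (simp add: o_def frechet_derivative_eqI)
  qed
  show ?thesis
    by (simp add: chain[OF assms(1)] chain[OF smooth_frechet_derivative[OF assms(1)]])
qed

lemma linear_iter_dderiv_first:
  assumes "smooth \<phi>"
  shows "linear (\<lambda>u. iter_dderiv \<phi> [u, v] x)"
  using has_derivative_linear[OF smooth_has_derivative[OF smooth_frechet_derivative[OF assms]]]
  by (simp add: eta_contract_eq)

lemma linear_iter_dderiv_second:
  assumes "smooth \<phi>"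
  shows "linear (\<lambda>v. iter_dderiv \<phi> [u, v] x)"
proof (rule linearI)
  note lin = has_derivative_linear[OF smooth_has_derivative[OF assms]]
  note diff = smooth_imp_differentiable[OF smooth_frechet_derivative[OF assms]]
  fix v w c
  show "iter_dderiv \<phi> [u, v + w] x = iter_dderiv \<phi> [u, v] x + iter_dderiv \<phi> [u, w] x"
    by (simp add: linear_add[OF lin] frechet_derivative_add diff)
  show "iter_dderiv \<phi> [u, c *\<^sub>R v] x = c *\<^sub>R iter_dderiv \<phi> [u, v] x"
    using frechet_derivative_bounded_linear[OF bounded_linear_scaleR_right diff, of c]
    by (simp add: linear_scale[OF lin])
qed

section \<open>The wave operator as a metric trace\<close>

lemma sum_Basis_spacetime:
  fixes f :: "'n::finite spacetime \<Rightarrow> real"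
  shows "(\<Sum>b\<in>Basis. f b) = (\<Sum>i\<in>UNIV. f (space_dir i)) + f time_dir"
proof -
  have axes: "(\<Sum>b\<in>Basis. g b) = (\<Sum>i\<in>UNIV. g (axis i 1))" for g :: "real ^ 'n \<Rightarrow> real"
  proof -
    have "(Basis :: (real ^ 'n) set) = (\<lambda>i. axis i 1) ` UNIV"
      by (auto simp: Basis_vec_def)
    then have "(\<Sum>b\<in>Basis. g b) = (\<Sum>b\<in>(\<lambda>i. axis i 1) ` UNIV. g b)"
      by (rule arg_cong)
    also have "\<dots> = (\<Sum>i\<in>UNIV. g (axis i 1))"
      by (simp add: sum.reindex inj_def axis_eq_axis)
    finally show ?thesis .
  qed
  show ?thesis
    unfolding Basis_prod_def
    by (subst sum.union_disjoint)
      (auto simp: sum.reindex inj_on_def axes space_dir_def time_dir_def)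
qed

lemma time_reflection_dirs [simp]:
  "time_reflection (space_dir i) = space_dir i" "time_reflection time_dir = - time_dir"
  by (simp_all add: time_reflection_def space_dir_def time_dir_def)

text \<open>Reflecting one slot of the Hessian gives the time direction its minus sign, by linearity
  in that slot.\<close>

lemma wave_eq_trace:
  assumes "smooth \<phi>"
  shows "wave \<phi> x = (\<Sum>b\<in>Basis. iter_dderiv \<phi> [b, time_reflection b] x)"
  unfolding wave_def sum_Basis_spacetime time_reflection_dirs
    linear_neg[OF linear_iter_dderiv_second[OF assms]] by simp

lemma mink_self_eq_sum:
  "mink a a = (\<Sum>i\<in>UNIV. (space_dir i \<bullet> a)\<^sup>2) - (time_dir \<bullet> a)\<^sup>2"
  by (simp add: mink_def inner_vec_def[of "fst a"] space_dir_def time_dir_def inner_prod_def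
      inner_axis' power2_eq_square)

text \<open>The Leibniz rule leaves the Minkowski square of the gradient \<open>a\<close>. Hence if
  \<open>f\<close> and its square both solve the wave equation, the gradient is null.\<close>

lemma wave_square:
  assumes "smooth f" and deriv: "\<And>v. frechet_derivative f (at x) v = v \<bullet> a"
  shows "wave (\<lambda>x. f x * f x) x = 2 * (f x * wave f x + mink a a)"
  unfolding wave_def iter_dderiv_square[OF assms(1)] deriv mink_self_eq_sum
  by (simp add: sum.distrib sum_distrib_left algebra_simps)

text \<open>Expanding \<open>H\<close> in the basis reduces the claim to the coefficient matrix
  \<open>coeff\<close>: the metric transported by \<open>M\<close>, which is \<open>k\<close> times
  the metric because the adjoint is conformal.\<close>

lemma bilinear_trace_conformal:
  fixes M :: "'n::finite spacetime \<Rightarrow> 'n spacetime" and H :: "'n spacetime \<Rightarrow> 'n spacetime \<Rightarrow> real"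
  assumes H: "\<And>v. linear (\<lambda>u. H u v)" "\<And>u. linear (H u)" and M: "linear M"
    and conf: "\<And>u v. mink (adjoint M u) (adjoint M v) = k * mink u v"
  shows "(\<Sum>b\<in>Basis. H (M b) (M (time_reflection b))) = k * (\<Sum>b\<in>Basis. H b (time_reflection b))"
proof -
  have expand1: "H u v = (\<Sum>c\<in>Basis. (u \<bullet> c) * H c v)" for u v
    using linear_sum[OF H(1), of "\<lambda>c. (u \<bullet> c) *\<^sub>R c" Basis v] linear_scale[OF H(1)]
    by (simp add: euclidean_representation)
  have expand2: "H u v = (\<Sum>d\<in>Basis. (v \<bullet> d) * H u d)" for u v
    using linear_sum[OF H(2), of u "\<lambda>c. (v \<bullet> c) *\<^sub>R c" Basis] linear_scale[OF H(2)]
    by (simp add: euclidean_representation)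
  have coeff: "(\<Sum>b\<in>Basis. (M b \<bullet> c) * (M (time_reflection b) \<bullet> d)) = k * (time_reflection c \<bullet> d)" for c d
  proof -
    have "(\<Sum>b\<in>Basis. (M b \<bullet> c) * (M (time_reflection b) \<bullet> d))
        = (\<Sum>b\<in>Basis. (adjoint M c \<bullet> b) * (time_reflection (adjoint M d) \<bullet> b))"
    proof (rule sum.cong[OF refl])
      fix b
      show "(M b \<bullet> c) * (M (time_reflection b) \<bullet> d)
          = (adjoint M c \<bullet> b) * (time_reflection (adjoint M d) \<bullet> b)"
        unfolding adjoint_works[OF M, symmetric]
        by (simp add: time_reflection_inner inner_commute)
    qed
    also have "\<dots> = mink (adjoint M c) (adjoint M d)"
      by (simp add: mink_eq_inner flip: euclidean_inner)
    finally show ?thesis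
      unfolding conf by (simp add: mink_eq_inner time_reflection_inner)
  qed
  have expand: "H u v = (\<Sum>c\<in>Basis. \<Sum>d\<in>Basis. (u \<bullet> c) * (v \<bullet> d) * H c d)" for u v
    unfolding expand1[of u v] by (rule sum.cong[OF refl], subst expand2) (simp add: sum_distrib_left mult.assoc)
  have "(\<Sum>b\<in>Basis. H (M b) (M (time_reflection b)))
      = (\<Sum>b\<in>Basis. \<Sum>c\<in>Basis. \<Sum>d\<in>Basis. (M b \<bullet> c) * (M (time_reflection b) \<bullet> d) * H c d)"
    by (rule sum.cong[OF refl], rule expand)
  also have "\<dots> = (\<Sum>c\<in>Basis. \<Sum>b\<in>Basis. \<Sum>d\<in>Basis. (M b \<bullet> c) * (M (time_reflection b) \<bullet> d) * H c d)"
    by (rule sum.swap)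
  also have "\<dots> = (\<Sum>c\<in>Basis. \<Sum>d\<in>Basis. \<Sum>b\<in>Basis. (M b \<bullet> c) * (M (time_reflection b) \<bullet> d) * H c d)"
    by (rule sum.cong[OF refl], rule sum.swap)
  also have "\<dots> = (\<Sum>c\<in>Basis. \<Sum>d\<in>Basis. k * (time_reflection c \<bullet> d) * H c d)"
    unfolding sum_distrib_right[symmetric] coeff by (rule refl)
  also have "\<dots> = (\<Sum>c\<in>Basis. k * H c (time_reflection c))"
    by (rule sum.cong[OF refl]) (subst (2) expand2, simp add: sum_distrib_left mult.assoc)
  finally show ?thesis by (simp only: sum_distrib_left)
qed

lemma wave_conformal_affine:
  fixes M :: "'n::finite spacetime \<Rightarrow> 'n spacetime"
  assumes "smooth \<phi>" and M: "linear M"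
    and conf: "\<And>u v. mink (M u) (M v) = k * mink u v" and "k \<noteq> 0"
  shows "wave (\<lambda>x. \<phi> (c + M x)) x = k * wave \<phi> (c + M x)"
proof -
  have bl: "bounded_linear M" using M by (rule linear_conv_bounded_linear[THEN iffD1])
  note H = linear_iter_dderiv_first[OF assms(1)] linear_iter_dderiv_second[OF assms(1)]
  have "wave (\<lambda>x. \<phi> (c + M x)) x = (\<Sum>i\<in>UNIV. iter_dderiv \<phi> [M (space_dir i), M (space_dir i)] (c + M x))
      - iter_dderiv \<phi> [M time_dir, M time_dir] (c + M x)"
    unfolding wave_def iter_dderiv_affine[OF assms(1) bl] by (rule refl)
  also have "\<dots> = (\<Sum>b\<in>Basis. iter_dderiv \<phi> [M b, M (time_reflection b)] (c + M x))"
    unfolding sum_Basis_spacetime time_reflection_dirs linear_neg[OF M] linear_neg[OF H(2)] by simp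
  also have "\<dots> = k * (\<Sum>b\<in>Basis. iter_dderiv \<phi> [b, time_reflection b] (c + M x))"
    by (rule bilinear_trace_conformal[OF H M adjoint_conformal[OF M conf \<open>k \<noteq> 0\<close>]])
  finally show ?thesis
    by (simp only: wave_eq_trace[OF assms(1)])
qed

section \<open>Wave invariance of affine causal automorphisms\<close>

text \<open>Null vectors going to null vectors yields the factor; the converse excludes
  \<open>k = 0\<close>, since \<open>time_dir\<close> is not null.\<close>

lemma affine_causal_automorphism_conformal:
  fixes L :: "'n::finite spacetime \<Rightarrow> 'n spacetime"
  assumes F: "causal_automorphism F" and L: "linear L" and FL: "\<And>x. F x = c + L x"
  obtains k where "k \<noteq> 0" "\<And>u v. mink (L u) (L v) = k * mink u v"
proof -
  have null: "mink (L v) (L v) = 0 \<longleftrightarrow> mink v v = 0" for v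
    using causal_automorphism_null[OF F, of v 0] by (simp add: FL linear_0[OF L])
  obtain k where k: "\<And>u v. mink (L u) (L v) = k * mink u v"
    using linear_null_imp_conformal[OF L] null by blast
  have "mink time_dir (time_dir :: 'n spacetime) \<noteq> 0"
    by (simp add: mink_time_dir) (simp add: time_dir_def)
  then have "k \<noteq> 0" using null[of time_dir] k[of time_dir time_dir] by auto
  then show thesis using k that by blast
qed

text \<open>The inverse of \<open>F\<close> is affine with conformal linear part
  \<open>inv L\<close> of factor \<open>inverse k\<close>, so composition with it only rescales the
  wave operator.\<close>

lemma wave_comp_inv_affine:
  fixes L :: "'n::finite spacetime \<Rightarrow> 'n spacetime"
  assumes F: "causal_automorphism F" and L: "linear L" and FL: "\<And>x. F x = c + L x"
    and "smooth \<phi>"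
  shows "(\<forall>x. wave \<phi> x = 0) \<longleftrightarrow> (\<forall>y. wave (\<phi> \<circ> inv F) y = 0)"
proof -
  obtain k where k: "k \<noteq> 0" "\<And>u v. mink (L u) (L v) = k * mink u v"
    using affine_causal_automorphism_conformal[OF F L FL] by blast
  have "bij F" using F by (simp add: causal_automorphism_def)
  have "L = (\<lambda>y. y - c) \<circ> F" by (simp add: fun_eq_iff FL)
  with \<open>bij F\<close> have "bij L"
    by (metis bij_comp bij_diff_right)
  define M where "M = inv L"
  have LM: "L (M y) = y" for y
    using \<open>bij L\<close> by (simp add: M_def bij_is_surj surj_f_inv_f)
  have "linear M"
    unfolding M_def using L \<open>bij L\<close> by (simp add: linear_injective_imp_surjective inj_linear_imp_inv_linear bij_is_inj)
  have "F (M (y - c)) = y" for y by (simp add: FL LM)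
  then have "inv F y = M (y - c)" for y
    using \<open>bij F\<close> by (metis bij_is_inj inv_f_f)
  then have inv: "inv F y = - M c + M y" for y
    by (simp add: linear_diff[OF \<open>linear M\<close>])
  have "mink (M u) (M v) = inverse k * mink u v" for u v
    using k(2)[of "M u" "M v"] k(1) by (simp add: LM field_simps)
  from wave_conformal_affine[OF \<open>smooth \<phi>\<close> \<open>linear M\<close> this, of "- M c"] k(1)
  have "wave (\<phi> \<circ> inv F) y = inverse k * wave \<phi> (inv F y)" for y
    by (simp add: o_def inv)
  moreover have "x \<in> range (inv F)" for x
    using \<open>bij F\<close> by (metis bij_imp_bij_inv bij_is_surj UNIV_I)
  ultimately show ?thesis using k(1)
    by (metis mult_eq_0_iff inverse_nonzero_iff_nonzero rangeE)
qed

section \<open>Wave-invariant diffeomorphisms\<close>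

lemma snd_iter_dderiv:
  assumes "F differentiable (at x)"
  shows "iter_dderiv (\<lambda>p. snd (F p)) [v] x = snd (frechet_derivative F (at x) v)"
  using frechet_derivative_bounded_linear[OF bounded_linear_snd assms] by simp

lemma wave_inner_0: "wave (\<lambda>x. x \<bullet> u) y = 0"
proof -
  have "frechet_derivative (\<lambda>x. x \<bullet> u) (at x) = (\<lambda>v. v \<bullet> u)" for x
    by (rule frechet_derivative_eqI) (auto intro!: derivative_eq_intros)
  then show ?thesis by (simp add: wave_def frechet_derivative_const)
qed

lemma smooth_id: "smooth (\<lambda>x. x)"
proof (rule smooth_coinduct[where P = "\<lambda>f. f = (\<lambda>x. x) \<or> (\<exists>c. f = (\<lambda>_. c))"])
  have "frechet_derivative (\<lambda>x :: 'a. x) (at x) = (\<lambda>v. v)" for x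
    by (rule frechet_derivative_eqI) (rule has_derivative_ident)
  moreover fix f :: "'a \<Rightarrow> 'a" and v
  assume "f = (\<lambda>x. x) \<or> (\<exists>c. f = (\<lambda>_. c))"
  ultimately show "(\<lambda>x. frechet_derivative f (at x) v) = (\<lambda>x. x) \<or>
      (\<exists>c. (\<lambda>x. frechet_derivative f (at x) v) = (\<lambda>_. c))"
    by (auto simp: frechet_derivative_const)
qed auto

text \<open>The adjoint derivative at \<open>u\<close> is the gradient of \<open>?f\<close>. Both
  \<open>?f\<close> and its square solve the wave equation, being pullbacks of
  \<open>y \<bullet> u\<close> and its square, so \<open>wave_square\<close> forces this gradient to
  be null.\<close>

lemma wave_invariant_adjoint_null:
  fixes F :: "'n::finite spacetime \<Rightarrow> 'n spacetime"
  assumes F: "diffeomorphism F"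
    and wave: "\<And>\<phi> :: 'n spacetime \<Rightarrow> real. smooth \<phi> \<Longrightarrow>
      \<forall>y. wave (\<phi> \<circ> inv F) y = 0 \<Longrightarrow> \<forall>x. wave \<phi> x = 0"
    and u: "mink u u = 0"
  shows "mink (adjoint (frechet_derivative F (at x)) u) (adjoint (frechet_derivative F (at x)) u) = 0"
proof -
  have "bij F" and "smooth F" using F by (auto simp: diffeomorphism_def)
  then have inv: "F (inv F y) = y" for y by (simp add: bij_is_surj surj_f_inv_f)
  let ?f = "\<lambda>x. F x \<bullet> u"
  have smooth: "smooth ?f"
    by (rule smooth_bounded_linear[OF bounded_linear_inner_left \<open>smooth F\<close>])
  have f: "wave ?f x = 0" for x
    by (rule spec[OF wave[OF smooth]]) (simp add: o_def inv wave_inner_0)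
  have "smooth (\<lambda>y :: 'n spacetime. y \<bullet> u)"
    by (rule smooth_bounded_linear[OF bounded_linear_inner_left smooth_id])
  moreover have "frechet_derivative (\<lambda>x. x \<bullet> u) (at x) = (\<lambda>v. v \<bullet> u)" for x :: "'n spacetime"
    by (rule frechet_derivative_eqI) (auto intro!: derivative_eq_intros)
  ultimately have "wave (\<lambda>y. (y \<bullet> u) * (y \<bullet> u)) y = 0" for y
    by (subst wave_square[where a = u]) (simp_all add: wave_inner_0 u)
  then have "wave (\<lambda>x. ?f x * ?f x) x = 0"
    by (intro spec[OF wave[OF smooth_mult[OF smooth smooth]]]) (simp add: o_def inv)
  moreover have "frechet_derivative ?f (at x) v = v \<bullet> adjoint (frechet_derivative F (at x)) u" for v
    using frechet_derivative_bounded_linear[OF bounded_linear_inner_left smooth_imp_differentiable[OF \<open>smooth F\<close>]]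
      adjoint_works[OF has_derivative_linear[OF smooth_has_derivative[OF \<open>smooth F\<close>]]] by simp
  ultimately show ?thesis
    by (simp add: wave_square[OF smooth] f)
qed

text \<open>In dimension \<open>1 + 1\<close> the factor \<open>k\<close> may be negative: exchanging space and time
  maps null vectors to null vectors.\<close>

lemma conformal_factor_nonneg:
  fixes M :: "'n::finite spacetime \<Rightarrow> 'n spacetime"
  assumes dim: "CARD('n) \<ge> 2" and M: "linear M"
    and conf: "\<And>u v. mink (M u) (M v) = k * mink u v"
  shows "k \<ge> 0"
proof -
  obtain e :: "real ^ 'n" where "e \<noteq> 0"
    by (metis axis_eq_0_iff zero_neq_one)
  obtain f :: "real ^ 'n" where "f \<noteq> 0" "orthogonal e f"
    using orthogonal_to_vector_exists[of e] dim by (auto simp: DIM_cart)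
  \<comment> \<open>Chosen so that the time components of \<open>a *\<^sub>R M (e, 0)\<close> and
    \<open>b *\<^sub>R M (f, 0)\<close> cancel. The combination is spacelike and its image purely
    spatial, which settles the sign of \<open>k\<close>.\<close>
  define a b where "a = snd (M (f, 0))" and "b = - snd (M (e, 0))"
  have ef: "mink (e, 0) (f, 0) = 0" "mink (e, 0) (e, 0) > 0" "mink (f, 0) (f, 0) > 0"
    using \<open>e \<noteq> 0\<close> \<open>f \<noteq> 0\<close> \<open>orthogonal e f\<close> by (simp_all add: mink_def orthogonal_def)
  show ?thesis
  proof (cases "a = 0")
    case True
    then have "0 \<le> mink (M (f, 0)) (M (f, 0))"
      by (simp add: mink_def a_def)
    then show ?thesis using ef by (simp add: conf zero_le_mult_iff)
  next
    case False
    let ?w = "a *\<^sub>R (e, 0) + b *\<^sub>R (f, 0) :: 'n spacetime"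
    have "snd (M ?w) = 0"
      by (simp only: linear_add[OF M] linear_scale[OF M]) (simp add: a_def b_def)
    then have "0 \<le> mink (M ?w) (M ?w)"
      by (simp add: mink_def)
    moreover have "mink ?w ?w = a\<^sup>2 * mink (e, 0) (e, 0) + b\<^sup>2 * mink (f, 0) (f, 0)"
      using ef(1) mink_commute[of "(f, 0)" "(e, 0)"] by (simp add: mink_simps power2_eq_square del: scaleR_Pair)
    then have "mink ?w ?w > 0"
      using ef(2,3) False by (simp only:) (intro add_pos_nonneg mult_pos_pos mult_nonneg_nonneg, auto)
    ultimately show ?thesis by (simp only: conf zero_le_mult_iff) linarith
  qed
qed

section \<open>From the causal cone of the derivative to the causal order\<close>

text \<open>A positive factor keeps causal vectors causal. Future and past are told apart by the
  sign of the product with \<open>?T\<close>, which is itself in the future cone by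
  \<open>time\<close>.\<close>

lemma conformal_preserves_causal_cone:
  fixes M :: "'n::finite spacetime \<Rightarrow> 'n spacetime"
  assumes "linear M" and conf: "\<And>u v. mink (M u) (M v) = k * mink u v" and "k > 0"
    and time: "snd (M time_dir) \<ge> 0"
  shows "M v \<in> causal_cone \<longleftrightarrow> v \<in> causal_cone"
proof -
  let ?T = "M time_dir"
  have "mink ?T ?T \<le> 0"
    using \<open>k > 0\<close> by (simp add: conf mink_time_dir) (simp add: time_dir_def)
  then have T: "?T \<in> causal_cone"
    using time by (simp add: causal_cone_def mink_self_le_0_iff)
  have image: "M v \<in> causal_cone" if v: "v \<in> causal_cone" for v
  proof (cases "v = 0")
    case True
    then show ?thesis by (simp add: linear_0[OF \<open>linear M\<close>] causal_cone_def)
  next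
    case False
    have "snd v > 0"
      using v False by (auto simp: causal_cone_def prod_eq_iff intro: order_trans[OF norm_ge_zero] order.not_eq_order_implies_strict)
    then have "mink (M v) ?T < 0"
      using \<open>k > 0\<close> by (simp add: conf mink_time_dir)
    moreover have "mink (- M v) ?T \<le> 0" if "- M v \<in> causal_cone"
      using mink_causal_cone_le_0[OF that T] .
    moreover have "mink (M v) (M v) \<le> 0"
      using v \<open>k > 0\<close> causal_cone_or_uminus[of v] by (simp add: conf mult_le_0_iff)
    ultimately show ?thesis
      using causal_cone_or_uminus[of "M v"] by (auto simp: mink_simps)
  qed
  show ?thesis
  proof
    assume Mv: "M v \<in> causal_cone"
    then have "mink v v \<le> 0"
      using causal_cone_or_uminus[of "M v"] \<open>k > 0\<close> by (simp add: conf mult_le_0_iff)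
    then consider "v \<in> causal_cone" | "- v \<in> causal_cone"
      using causal_cone_or_uminus by blast
    then show "v \<in> causal_cone"
    proof cases
      case 2
      then have "- M v \<in> causal_cone"
        using image[of "- v"] by (simp add: linear_neg[OF \<open>linear M\<close>])
      with Mv have "M v = 0" by (rule causal_cone_pointed)
      then have "k * mink v w = 0" for w
        using conf[of v w] by (simp add: mink_simps)
      \<comment> \<open>Nondegeneracy: \<open>v\<close> is orthogonal to everything, and its own
        reflection is the test vector that gives its Euclidean square.\<close>
      then have "v \<bullet> time_reflection (time_reflection v) = 0"
        using \<open>k > 0\<close> by (simp only: mink_eq_inner[symmetric]) simp
      then show ?thesis by (simp add: causal_cone_def)
    qed
  qed (rule image)
qed

text \<open>Paired with a fixed \<open>w\<close> of the cone, \<open>F\<close> along the segment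
  from \<open>p\<close> to \<open>q\<close> is a real function with nonpositive derivative;
  self-duality then recovers membership in the cone.\<close>

lemma derivative_preserves_causal_cone_imp_causal_le:
  assumes "\<And>x. (F has_derivative D x) (at x)"
    and cone: "\<And>x v. v \<in> causal_cone \<Longrightarrow> D x v \<in> causal_cone"
    and "causal_le p q"
  shows "causal_le (F p) (F q)"
  unfolding causal_le_iff
proof (rule causal_cone_self_dual)
  fix w :: "'b spacetime" assume w: "w \<in> causal_cone"
  define v where "v = q - p"
  have v: "v \<in> causal_cone" using assms(3) by (simp add: causal_le_iff v_def)
  have bl: "bounded_linear (\<lambda>y. mink y w)"
    unfolding mink_eq_inner by (rule bounded_linear_inner_left)
  have deriv: "((\<lambda>t. mink (F (p + t *\<^sub>R v)) w) has_real_derivative mink (D (p + t *\<^sub>R v) v) w) (at t)" for t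
  proof -
    have "((\<lambda>t. p + t *\<^sub>R v) has_derivative (\<lambda>h. h *\<^sub>R v)) (at t)"
      by (auto intro!: derivative_eq_intros)
    from bounded_linear.has_derivative[OF bl diff_chain_at[OF this assms(1)]]
    show ?thesis
      by (simp add: o_def linear_scale[OF has_derivative_linear[OF assms(1)]] mink_simps
          has_field_derivative_def mult_commute_abs)
  qed
  have "mink (F (p + 1 *\<^sub>R v)) w \<le> mink (F (p + 0 *\<^sub>R v)) w"
  proof (rule DERIV_nonpos_imp_nonincreasing[where f = "\<lambda>t. mink (F (p + t *\<^sub>R v)) w"])
    fix t :: real
    have "mink (D (p + t *\<^sub>R v) v) w \<le> 0"
      using cone[OF v] w by (rule mink_causal_cone_le_0)
    then show "\<exists>y. ((\<lambda>t. mink (F (p + t *\<^sub>R v)) w) has_real_derivative y) (at t) \<and> y \<le> 0"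
      using deriv[of t] by blast
  qed simp
  then show "mink (F q - F p) w \<le> 0"
    by (simp add: mink_simps v_def)
qed

lemma wave_invariant_imp_causal_automorphism:
  fixes F :: "'n::finite spacetime \<Rightarrow> 'n spacetime"
  assumes dim: "CARD('n) \<ge> 2" and F: "diffeomorphism F"
    and time: "\<And>x. snd (frechet_derivative F (at x) time_dir) \<ge> 0"
    and wave: "\<And>\<phi> :: 'n spacetime \<Rightarrow> real. smooth \<phi> \<Longrightarrow>
      \<forall>y. wave (\<phi> \<circ> inv F) y = 0 \<Longrightarrow> \<forall>x. wave \<phi> x = 0"
  shows "causal_automorphism F"
proof -
  let ?D = "\<lambda>x. frechet_derivative F (at x)" and ?E = "\<lambda>x. frechet_derivative (inv F) (at x)"
  have "bij F" and smooth: "smooth F" "smooth (inv F)" using F by (auto simp: diffeomorphism_def)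
  then have inv: "F (inv F y) = y" "inv F (F y) = y" for y
    by (simp_all add: bij_is_surj bij_is_inj surj_f_inv_f)
  note D = smooth_has_derivative[OF smooth(1)] and E = smooth_has_derivative[OF smooth(2)]
  note linD = has_derivative_linear[OF D]
  have DE: "?D (inv F y) (?E y v) = v" for y v
  proof -
    have "(F \<circ> inv F has_derivative ?D (inv F y) \<circ> ?E y) (at y)"
      by (rule diff_chain_at[OF E D])
    then have "((\<lambda>y. y) has_derivative ?D (inv F y) \<circ> ?E y) (at y)"
      by (simp add: o_def inv)
    from fun_cong[OF has_derivative_unique[OF this has_derivative_ident], of v] show ?thesis
      by simp
  qed
  have conformal: "\<exists>k>0. \<forall>u v. mink (?D x u) (?D x v) = k * mink u v" for x
  proof -
    let ?A = "adjoint (?D x)"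
    have linA: "linear ?A" by (rule adjoint_linear[OF linD])
    obtain k where k: "\<And>u v. mink (?A u) (?A v) = k * mink u v"
      using linear_null_imp_conformal[OF linA] wave_invariant_adjoint_null[OF F wave] by blast
    \<comment> \<open>For \<open>k = 0\<close> every value of the adjoint would be null, but it is
      injective by \<open>DE\<close>, hence surjective, and reaches \<open>time_dir\<close>.\<close>
    have "k \<noteq> 0"
    proof
      assume "k = 0"
      have A: "mink (?A u) (?A v) = 0" for u v using k \<open>k = 0\<close> by simp
      have "adjoint (?D x) u = 0 \<Longrightarrow> u = 0" for u
      proof -
        assume "?A u = 0"
        then have "?D x (?E (F x) u) \<bullet> u = 0"
          by (simp add: adjoint_works[OF linD, symmetric])
        then show "u = 0" using DE[of "F x" u] by (simp add: inv)
      qed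
      then have "inj ?A"
        using linA by (simp add: linear_injective_0)
      then have "surj ?A" by (rule linear_inj_imp_surj[OF linA])
      then obtain u where "?A u = time_dir" by (metis surjD)
      with A[of u u] show False by (simp add: mink_time_dir) (simp add: time_dir_def)
    qed
    \<comment> \<open>Taking the adjoint once more carries conformality from \<open>?A\<close> back
      to the derivative itself.\<close>
    then have "mink (?D x u) (?D x v) = k * mink u v" for u v
      using adjoint_conformal[OF linA k] by (simp add: adjoint_adjoint[OF linD])
    moreover from this have "k \<ge> 0" by (rule conformal_factor_nonneg[OF dim linD])
    ultimately show ?thesis using \<open>k \<noteq> 0\<close> by (intro exI[of _ k]) auto
  qed
  have cone: "?D x v \<in> causal_cone \<longleftrightarrow> v \<in> causal_cone" for x v
  proof -
    obtain k where "k > 0" "\<forall>u v. mink (?D x u) (?D x v) = k * mink u v"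
      using conformal by blast
    then show ?thesis
      using conformal_preserves_causal_cone[OF linD _ _ time] by blast
  qed
  have "causal_le (F p) (F q)" if "causal_le p q" for p q
    by (rule derivative_preserves_causal_cone_imp_causal_le[OF D _ that]) (simp add: cone)
  moreover have "causal_le (inv F p) (inv F q)" if "causal_le p q" for p q
  proof (rule derivative_preserves_causal_cone_imp_causal_le[OF E _ that])
    fix x and v :: "'n spacetime" assume "v \<in> causal_cone"
    \<comment> \<open>The equivalence in \<open>cone\<close> is read backwards here, as
      \<open>DE\<close> makes \<open>?E x v\<close> a preimage of \<open>v\<close>.\<close>
    then show "?E x v \<in> causal_cone" using cone[of "inv F x" "?E x v"] by (simp add: DE)
  qed
  ultimately show ?thesis
    unfolding causal_automorphism_def using \<open>bij F\<close> inv(2) by metis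
qed

theorem theorem2p3:
  fixes F :: "'n::finite spacetime \<Rightarrow> 'n spacetime"
  assumes "CARD('n) \<ge> 2"
    and "diffeomorphism F"
  shows "causal_automorphism F \<longleftrightarrow>
           ((\<forall>x. iter_dderiv (\<lambda>p. snd (F p)) [time_dir] x \<ge> 0) \<and>
            (\<forall>\<phi> :: 'n spacetime \<Rightarrow> real. smooth \<phi> \<longrightarrow>
               ((\<forall>x. wave \<phi> x = 0) \<longleftrightarrow> (\<forall>y. wave (\<phi> \<circ> inv F) y = 0))))"
    (is "_ \<longleftrightarrow> ?time \<and> ?wave")
proof -
  have diff: "F differentiable (at x)" for x
    using assms(2) by (simp add: diffeomorphism_def smooth_imp_differentiable)
  show ?thesis
  proof
    assume F: "causal_automorphism F"
    obtain L where L: "linear L" and FL: "\<And>x. F x = F 0 + L x"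
      using causal_automorphism_affine[OF F assms(1) diff] by blast
    have "frechet_derivative F (at x) = L" for x
    proof (rule frechet_derivative_eqI)
      have "((\<lambda>x. F 0 + L x) has_derivative L) (at x)"
        using linear_imp_has_derivative[OF L] by (auto intro!: derivative_eq_intros)
      then show "(F has_derivative L) (at x)"
        by (simp only: FL[abs_def, symmetric])
    qed
    moreover have "snd (L time_dir) \<ge> 0"
    proof -
      have "causal_le 0 (time_dir :: 'n spacetime)"
        by (simp add: causal_le_iff causal_cone_def time_dir_def)
      then have "causal_le (F 0) (F time_dir)"
        using F by (simp add: causal_automorphism_def del: split_paired_All)
      then have "L time_dir \<in> causal_cone"
        unfolding causal_le_iff FL[of time_dir] by simp
      then show ?thesis
        by (auto simp: causal_cone_def intro: order_trans[OF norm_ge_zero])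
    qed
    ultimately have ?time by (simp only: snd_iter_dderiv[OF diff]) simp
    moreover have ?wave
      using wave_comp_inv_affine[OF F L FL] by blast
    ultimately show "?time \<and> ?wave" ..
  next
    assume "?time \<and> ?wave"
    then show "causal_automorphism F"
      by (intro wave_invariant_imp_causal_automorphism[OF assms])
        (simp_all only: snd_iter_dderiv[OF diff], blast+)
  qed
qed

end
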